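(* Let $\mathcal{A}$ be a Banach algebra, let $a,b\in\mathcal{A}$, and suppose that $az=zb$ for some $z\in\mathcal{A}$. (i) If $x$ is a left Drazin inverse of $a$ and $y$ is a right Drazin inverse of $b$, then $xz=zy$. (ii) If $x$ is a left generalized Drazin inverse of $a$ and $y$ is a right generalized Drazin inverse of $b$, then $xz=zy$.
   Context: $\mathcal{A}$ is a complex unital Banach algebra, $r(\cdot)$ denotes the spectral radius, and $\mathcal{A}^{qnil}=\{a\in\mathcal{A}: r(a)=0\}$ is the set of quasi-nilpotent elements. Let $a\in\mathcal{A}$. - $x\in\mathcal{A}$ is a left Drazin inverse of $a$ if $axa=xa^2$, $x^2a=x$ and $xa^{j+1}=a^j$ for some non-negative integer $j$. - $y\in\mathcal{A}$ is a right Drazin inverse of $a$ if $aya=a^2y$, $ay^2=y$ and $a^{j+1}y=a^j$ for some non-negative integer $j$. - $x\in\mathcal{A}$ is a left generalized Drazin inverse of $a$ if $axa=xa^2$, $x^2a=x$ and $axa-a\in\mathcal{A}^{qnil}$. - $y\in\mathcal{A}$ is a right generalized Drazin inverse of $a$ if $aya=a^2y$, $ay^2=y$ and $aya-a\in\mathcal{A}^{qnil}$. *)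

theory Defs
  imports "HOL-Analysis.Analysis"
begin

text \<open>
  The distribution only has real normed algebras. A complex one is a real one with a
  compatible complex scalar multiplication; \<open>scaleR_eq_scaleC\<close> makes the real structure
  the restriction of the complex one, so it carries no extra information.
\<close>

class scaleC =
  fixes scaleC :: "complex \<Rightarrow> 'a \<Rightarrow> 'a"  (infixr "*\<^sub>C" 75)

class complex_banach_algebra_1 = real_normed_algebra_1 + banach + scaleC +
  assumes scaleC_add_right: "c *\<^sub>C (x + y) = c *\<^sub>C x + c *\<^sub>C y"
    and scaleC_add_left: "(c + d) *\<^sub>C x = c *\<^sub>C x + d *\<^sub>C x"
    and scaleC_scaleC: "c *\<^sub>C d *\<^sub>C x = (c * d) *\<^sub>C x"
    and scaleC_one: "1 *\<^sub>C x = x"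
    and scaleR_eq_scaleC: "r *\<^sub>R x = complex_of_real r *\<^sub>C x"
    and mult_scaleC_left: "(c *\<^sub>C x) * y = c *\<^sub>C (x * y)"
    and mult_scaleC_right: "x * (c *\<^sub>C y) = c *\<^sub>C (x * y)"
    and norm_scaleC: "norm (c *\<^sub>C x) = cmod c * norm x"

instantiation complex :: complex_banach_algebra_1
begin

definition scaleC_complex :: "complex \<Rightarrow> complex \<Rightarrow> complex"
  where "scaleC_complex c x = c * x"

instance
  by standard (simp_all add: scaleC_complex_def algebra_simps norm_mult scaleR_conv_of_real)

end

definition two_sided_invertible :: "'a::monoid_mult \<Rightarrow> bool"
  where "two_sided_invertible a \<longleftrightarrow> (\<exists>b. a * b = 1 \<and> b * a = 1)"

definition spectrum :: "'a::complex_banach_algebra_1 \<Rightarrow> complex set"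
  where "spectrum a = {c. \<not> two_sided_invertible (a - c *\<^sub>C 1)}"

text \<open>The spectrum is nonempty and bounded, so the supremum is a genuine one.\<close>

definition spectral_radius :: "'a::complex_banach_algebra_1 \<Rightarrow> real"
  where "spectral_radius a = (SUP c\<in>spectrum a. cmod c)"

definition quasinilpotents :: "'a::complex_banach_algebra_1 set"
  where "quasinilpotents = {a. spectral_radius a = 0}"

text \<open>In the four predicates below the candidate inverse is the second argument.\<close>

definition left_Drazin_inverse :: "'a::monoid_mult \<Rightarrow> 'a \<Rightarrow> bool"
  where "left_Drazin_inverse a x \<longleftrightarrow>
    a * x * a = x * a^2 \<and> x^2 * a = x \<and> (\<exists>j::nat. x * a^(j + 1) = a^j)"

definition right_Drazin_inverse :: "'a::monoid_mult \<Rightarrow> 'a \<Rightarrow> bool"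
  where "right_Drazin_inverse a y \<longleftrightarrow>
    a * y * a = a^2 * y \<and> a * y^2 = y \<and> (\<exists>j::nat. a^(j + 1) * y = a^j)"

definition left_gen_Drazin_inverse :: "'a::complex_banach_algebra_1 \<Rightarrow> 'a \<Rightarrow> bool"
  where "left_gen_Drazin_inverse a x \<longleftrightarrow>
    a * x * a = x * a^2 \<and> x^2 * a = x \<and> a * x * a - a \<in> quasinilpotents"

definition right_gen_Drazin_inverse :: "'a::complex_banach_algebra_1 \<Rightarrow> 'a \<Rightarrow> bool"
  where "right_gen_Drazin_inverse a y \<longleftrightarrow>
    a * y * a = a^2 * y \<and> a * y^2 = y \<and> a * y * a - a \<in> quasinilpotents"

end

theory Submission
  imports Defs
begin

text \<open>
  Put \<open>p = x * a\<close> and \<open>q = b * y\<close>. The algebraic identities make \<open>p\<close> and \<open>q\<close> idempotents that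
  commute with \<open>a\<close> and \<open>b\<close> respectively, with \<open>p = x ^ n * a ^ n\<close>, \<open>q = b ^ n * y ^ n\<close>,
  \<open>(1 - p) * a ^ n = (a - a * x * a) ^ n\<close> and \<open>b ^ n * (1 - q) = (b - b * y * b) ^ n\<close> for all
  \<open>n \<ge> 1\<close>. Since \<open>a ^ n * z = z * b ^ n\<close>, this gives
  \<open>(1 - p) * z * q = (a - a * x * a) ^ n * z * y ^ n\<close> and
  \<open>p * z * (1 - q) = x ^ n * z * (b - b * y * b) ^ n\<close>. If the powers of the two differences decay
  faster than every geometric sequence, both left-hand sides vanish, so \<open>p * z = z * q\<close>, and then
  \<open>x * z = x * p * z = x * z * b * y = x * a * z * y = z * q * y = z * y\<close>
  (\<open>intertwined_inverses\<close>). Both kinds of inverses are special cases: for Drazin inverses the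
  differences are nilpotent, for generalized Drazin inverses they are quasinilpotent.

  What remains is that the powers of a quasinilpotent element \<open>c\<close> decay in this way
  (\<open>quasinilpotents_scaled_powers\<close>), which is the nontrivial half of the spectral radius formula
  at radius 0. The proof is Rickart's, which uses no integration. The function
  \<open>u w = inverse (1 - w c)\<close> is defined on the whole plane and Lipschitz on each disc. Averaging it
  over the points \<open>\<omega> ^ k * r\<close>, with \<open>\<omega>\<close> a primitive \<open>n\<close>-th root of unity, gives the inverse of
  \<open>1 - r ^ n c ^ n\<close> (\<open>resolvent_average_inverse\<close>). Hence these inverses depend on \<open>r\<close> with a
  Lipschitz constant that does not depend on \<open>n\<close>, so the property \<open>r ^ n c ^ n \<longlonglongrightarrow> 0\<close> passes from
  \<open>r\<close> to radii larger by a fixed amount (\<open>scaled_powers_step\<close>). Finitely many steps lead from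
  radius 0 to any given radius.
\<close>

section \<open>Complex scalars\<close>

lemma scaleC_zero_left: "0 *\<^sub>C (x::'a::complex_banach_algebra_1) = 0"
  using scaleC_add_left[of 0 0 x] by simp

lemma scaleC_diff_left:
  "(c - d) *\<^sub>C (x::'a::complex_banach_algebra_1) = c *\<^sub>C x - d *\<^sub>C x"
  using scaleC_add_left[of "c - d" d x] by (simp add: algebra_simps)

lemma scaleC_minus_left: "(- c) *\<^sub>C (x::'a::complex_banach_algebra_1) = - (c *\<^sub>C x)"
  using scaleC_diff_left[of 0 c x] by (simp add: scaleC_zero_left)

lemma scaleC_diff_right:
  "c *\<^sub>C ((x::'a::complex_banach_algebra_1) - y) = c *\<^sub>C x - c *\<^sub>C y"
  using scaleC_add_right[of c "x - y" y] by (simp add: algebra_simps)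

lemma scaleC_sum_left:
  "(\<Sum>k\<in>A. f k) *\<^sub>C (x::'a::complex_banach_algebra_1) = (\<Sum>k\<in>A. f k *\<^sub>C x)"
  by (induction A rule: infinite_finite_induct) (simp_all add: scaleC_zero_left scaleC_add_left)

lemma power_scaleC:
  "(c *\<^sub>C (x::'a::complex_banach_algebra_1)) ^ n = c ^ n *\<^sub>C x ^ n"
  by (induction n)
    (simp_all add: scaleC_one mult_scaleC_left mult_scaleC_right scaleC_scaleC mult.commute)

section \<open>Spectral radius zero\<close>

lemma two_sided_invertible_one_minus:
  fixes x :: "'a::{real_normed_algebra_1,banach}"
  assumes "norm x < 1"
  shows "two_sided_invertible (1 - x)"
proof -
  have s: "summable (\<lambda>n. x ^ n)"
    using assms by (rule complete_algebra_summable_geometric)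
  have head: "(\<Sum>n. x ^ n) = 1 + (\<Sum>n. x ^ Suc n)"
    using suminf_split_head[OF s] by simp
  have "(\<Sum>n. x ^ Suc n) = x * (\<Sum>n. x ^ n)" "(\<Sum>n. x ^ Suc n) = (\<Sum>n. x ^ n) * x"
    using suminf_mult[OF s, of x] suminf_mult2[OF s, of x] by (simp_all add: power_commutes)
  with head have "(1 - x) * (\<Sum>n. x ^ n) = 1" "(\<Sum>n. x ^ n) * (1 - x) = 1"
    by (simp_all add: algebra_simps)
  then show ?thesis
    unfolding two_sided_invertible_def by blast
qed

lemma two_sided_invertible_scaleC:
  fixes x :: "'a::complex_banach_algebra_1"
  assumes "two_sided_invertible x" "c \<noteq> 0"
  shows "two_sided_invertible (c *\<^sub>C x)"
proof -
  obtain y where "x * y = 1" "y * x = 1"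
    using assms(1) unfolding two_sided_invertible_def by blast
  then have "(c *\<^sub>C x) * (inverse c *\<^sub>C y) = 1" "(inverse c *\<^sub>C y) * (c *\<^sub>C x) = 1"
    using assms(2) by (simp_all add: mult_scaleC_left mult_scaleC_right scaleC_scaleC scaleC_one)
  then show ?thesis
    unfolding two_sided_invertible_def by blast
qed

text \<open>
  This bound is what turns the supremum in the definition of the spectral radius into an upper
  bound for the moduli of the points of the spectrum.
\<close>

lemma norm_le_if_in_spectrum:
  fixes a :: "'a::complex_banach_algebra_1"
  assumes "c \<in> spectrum a"
  shows "cmod c \<le> norm a"
proof (rule ccontr)
  assume "\<not> cmod c \<le> norm a"
  then have c: "norm a < cmod c" "c \<noteq> 0"
    by (auto simp: not_le le_less_trans[OF norm_ge_zero])
  then have "two_sided_invertible (1 - inverse c *\<^sub>C a)"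
    by (intro two_sided_invertible_one_minus)
      (simp add: norm_scaleC norm_inverse divide_inverse[symmetric] mult.commute)
  then have "two_sided_invertible ((- c) *\<^sub>C (1 - inverse c *\<^sub>C a))"
    using c(2) by (intro two_sided_invertible_scaleC) auto
  moreover have "(- c) *\<^sub>C (1 - inverse c *\<^sub>C a) = a - c *\<^sub>C 1"
    using c(2) by (simp add: scaleC_diff_right scaleC_minus_left scaleC_scaleC scaleC_one)
  ultimately show False
    using assms by (simp add: spectrum_def)
qed

text \<open>
  No nonzero number lies in the spectrum of \<open>c\<close>; rescale \<open>c - inverse w\<close> by \<open>- w\<close>.
\<close>

lemma quasinilpotents_invertible:
  fixes c :: "'a::complex_banach_algebra_1"
  assumes "c \<in> quasinilpotents"
  shows "two_sided_invertible (1 - w *\<^sub>C c)"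
proof (cases "w = 0")
  case True
  then show ?thesis by (auto simp: scaleC_zero_left two_sided_invertible_def)
next
  case False
  have "bdd_above (cmod ` spectrum c)"
    by (rule bdd_aboveI[of _ "norm c"]) (auto intro: norm_le_if_in_spectrum)
  then have "cmod v \<le> 0" if "v \<in> spectrum c" for v
    using cSUP_upper[of v "spectrum c" cmod] that assms
    by (simp add: quasinilpotents_def spectral_radius_def)
  then have "inverse w \<notin> spectrum c"
    using False by force
  then have "two_sided_invertible (c - inverse w *\<^sub>C 1)"
    by (simp add: spectrum_def)
  then have "two_sided_invertible ((- w) *\<^sub>C (c - inverse w *\<^sub>C 1))"
    using False by (intro two_sided_invertible_scaleC) auto
  moreover have "(- w) *\<^sub>C (c - inverse w *\<^sub>C 1) = 1 - w *\<^sub>C c"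
    using False by (simp add: scaleC_diff_right scaleC_minus_left scaleC_scaleC scaleC_one)
  ultimately show ?thesis by simp
qed

section \<open>Averages of the resolvent over roots of unity\<close>

lemma resolvent_identity:
  fixes c :: "'a::complex_banach_algebra_1"
  assumes l: "\<And>w. u w * (1 - w *\<^sub>C c) = 1" and r: "\<And>w. (1 - w *\<^sub>C c) * u w = 1"
  shows "u w - u v = u w * ((w - v) *\<^sub>C c) * u v"
proof -
  have "u w - u v = u w * ((1 - v *\<^sub>C c) * u v) - (u w * (1 - w *\<^sub>C c)) * u v"
    by (simp add: l r)
  also have "\<dots> = u w * ((w - v) *\<^sub>C c) * u v"
    by (simp add: algebra_simps scaleC_diff_left)
  finally show ?thesis .
qed

lemma norm_resolvent_diff_le:
  fixes c :: "'a::complex_banach_algebra_1"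
  assumes "\<And>w. u w * (1 - w *\<^sub>C c) = 1" "\<And>w. (1 - w *\<^sub>C c) * u w = 1"
  shows "norm (u w - u v) \<le> norm (u w) * (cmod (w - v) * norm c) * norm (u v)"
  unfolding resolvent_identity[OF assms]
  by (intro order_trans[OF norm_mult_ineq] mult_right_mono)
    (auto simp: norm_scaleC intro!: order_trans[OF norm_mult_ineq])

text \<open>
  The resolvent identity bounds \<open>u w\<close> near \<open>v\<close> in terms of \<open>u v\<close>: the factor \<open>norm (u w)\<close> on
  its right-hand side carries a coefficient below 1/2 there, and can be absorbed.
\<close>

lemma continuous_on_resolvent:
  fixes c :: "'a::complex_banach_algebra_1"
  assumes inv: "\<And>w. u w * (1 - w *\<^sub>C c) = 1" "\<And>w. (1 - w *\<^sub>C c) * u w = 1"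
  shows "continuous_on S u"
proof -
  have "isCont u v" for v
  proof -
    define k where "k = norm c * norm (u v)"
    have k: "k \<ge> 0" by (simp add: k_def)
    have "(\<lambda>w. cmod (w - v) * k) \<midarrow>v\<rightarrow> cmod (v - v) * k"
      by (intro tendsto_intros)
    then have ev: "\<forall>\<^sub>F w in at v. cmod (w - v) * k < 1/2"
      by (rule order_tendstoD) simp
    have bound: "norm (u w - u v) \<le> 2 * norm (u v) * (cmod (w - v) * k)"
      if *: "cmod (w - v) * k < 1/2" for w
    proof -
      have d: "norm (u w - u v) \<le> norm (u w) * (cmod (w - v) * k)"
        using norm_resolvent_diff_le[OF inv, of w v] by (simp add: k_def mult_ac)
      have "norm (u w) \<le> norm (u v) + norm (u w - u v)"
        by (metis norm_triangle_sub)
      moreover have "norm (u w) * (cmod (w - v) * k) \<le> norm (u w) * (1/2)"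
        using * by (intro mult_left_mono) auto
      ultimately have "norm (u w) \<le> 2 * norm (u v)"
        using d by simp
      then have "norm (u w) * (cmod (w - v) * k) \<le> 2 * norm (u v) * (cmod (w - v) * k)"
        using k by (intro mult_right_mono) auto
      with d show ?thesis by linarith
    qed
    have "(\<lambda>w. 2 * norm (u v) * (cmod (w - v) * k)) \<midarrow>v\<rightarrow> 2 * norm (u v) * (cmod (v - v) * k)"
      by (intro tendsto_intros)
    then have "(\<lambda>w. 2 * norm (u v) * (cmod (w - v) * k)) \<midarrow>v\<rightarrow> 0"
      by simp
    then have "(\<lambda>w. u w - u v) \<midarrow>v\<rightarrow> 0"
      by (rule Lim_null_comparison[rotated]) (use ev bound in \<open>auto elim: eventually_mono\<close>)
    then show ?thesis
      by (simp add: isCont_def LIM_zero_iff)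
  qed
  then show ?thesis
    by (simp add: continuous_at_imp_continuous_on)
qed

lemma sum_power_root_of_unity:
  assumes "j < n"
  shows "(\<Sum>k<n. (cis (2 * pi * real k / real n)) ^ j) = (if j = 0 then of_nat n else 0)"
proof (cases "j = 0")
  case False
  define w where "w = cis (2 * pi * real j / real n)"
  have n: "n > 0" using assms by simp
  have "inj_on (\<lambda>k. cis (2 * pi * real k / real n)) {..<n}"
    using Complex.bij_betw_roots_unity[OF n] by (simp add: bij_betw_def)
  from inj_onD[OF this, of j 0] have "w \<noteq> 1"
    using False assms by (auto simp: w_def)
  moreover have "w ^ n = 1"
    using n cis_multiple_2pi[of "real j"] by (simp add: w_def Complex.DeMoivre mult.commute)
  moreover have "cis (2 * pi * real k / real n) ^ j = w ^ k" for k
    by (simp add: w_def Complex.DeMoivre mult_ac)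
  ultimately show ?thesis
    using False by (simp add: geometric_sum)
qed simp

definition resolvent_average :: "(complex \<Rightarrow> 'a) \<Rightarrow> nat \<Rightarrow> real \<Rightarrow> 'a::real_vector"
  where "resolvent_average u n r =
    (\<Sum>k<n. u (cis (2 * pi * real k / real n) * complex_of_real r)) /\<^sub>R real n"

text \<open>
  For \<open>t = e r c\<close> with \<open>e ^ n = 1\<close>, the product of \<open>inverse (1 - t)\<close> and
  \<open>1 - r ^ n c ^ n = 1 - t ^ n\<close> is the finite geometric sum of the powers \<open>t ^ j\<close> with \<open>j < n\<close>.
  Summing over all \<open>n\<close>-th roots of unity \<open>e\<close> kills every power except \<open>j = 0\<close>.
\<close>

lemma resolvent_average_inverse:
  fixes c :: "'a::complex_banach_algebra_1"
  assumes l: "\<And>w. u w * (1 - w *\<^sub>C c) = 1" and n: "n > 0"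
  shows "resolvent_average u n r * (1 - r ^ n *\<^sub>R c ^ n) = 1"
proof -
  define e where "e k = cis (2 * pi * real k / real n)" for k
  have en: "e k ^ n = 1" for k
    using n cis_multiple_2pi[of "real k"] by (simp add: e_def Complex.DeMoivre mult.commute)
  have one: "u (e k * of_real r) * (1 - r ^ n *\<^sub>R c ^ n)
      = (\<Sum>j<n. (e k ^ j) *\<^sub>C (r ^ j *\<^sub>R c ^ j))" for k
  proof -
    define t where "t = (e k * of_real r) *\<^sub>C c"
    have tj: "t ^ j = (e k ^ j) *\<^sub>C (r ^ j *\<^sub>R c ^ j)" for j
      by (simp add: t_def power_scaleC power_mult_distrib scaleR_eq_scaleC scaleC_scaleC)
    have "1 - r ^ n *\<^sub>R c ^ n = 1 - t ^ n"
      by (simp add: tj en scaleC_one)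
    also have "\<dots> = (1 - t) * (\<Sum>j<n. t ^ j)"
      using sum_lessThan_telescope'[of "(^) t" n]
      by (simp add: sum_distrib_left left_diff_distrib)
    finally have "u (e k * of_real r) * (1 - r ^ n *\<^sub>R c ^ n)
        = (u (e k * of_real r) * (1 - t)) * (\<Sum>j<n. t ^ j)"
      by (simp add: mult.assoc)
    then show ?thesis
      by (simp add: t_def l) (simp add: tj flip: t_def)
  qed
  have "(\<Sum>k<n. u (e k * of_real r)) * (1 - r ^ n *\<^sub>R c ^ n)
      = (\<Sum>k<n. \<Sum>j<n. (e k ^ j) *\<^sub>C (r ^ j *\<^sub>R c ^ j))"
    by (simp add: sum_distrib_right one)
  also have "\<dots> = (\<Sum>j<n. (\<Sum>k<n. e k ^ j) *\<^sub>C (r ^ j *\<^sub>R c ^ j))"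
    by (subst sum.swap) (simp add: scaleC_sum_left)
  also have "\<dots> = (\<Sum>j<n. if j = 0 then of_nat n *\<^sub>C 1 else 0)"
    by (intro sum.cong) (auto simp: e_def sum_power_root_of_unity scaleC_zero_left)
  also have "\<dots> = real n *\<^sub>R 1"
    using n by (simp add: sum.delta scaleR_eq_scaleC)
  finally show ?thesis
    using n by (simp add: resolvent_average_def e_def)
qed

lemma norm_sum_over_n_le:
  fixes f :: "nat \<Rightarrow> 'a::real_normed_vector"
  assumes "\<And>k. k < n \<Longrightarrow> norm (f k) \<le> B" "n > 0"
  shows "norm ((\<Sum>k<n. f k) /\<^sub>R real n) \<le> B"
proof -
  have "norm (\<Sum>k<n. f k) \<le> (\<Sum>k<n. B)"
    using assms(1) by (intro sum_norm_le) auto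
  then show ?thesis
    using assms(2) by (simp add: field_simps)
qed

text \<open>
  Write \<open>A n r\<close> for the average, which is inverse to \<open>1 - r ^ n c ^ n\<close>. As \<open>r ^ n c ^ n \<longlonglongrightarrow> 0\<close>, the
  average \<open>A n r\<close> tends to 1; by the Lipschitz bound, \<open>A n s\<close> is eventually within 1/2 of 1. This
  only keeps \<open>s ^ n c ^ n\<close> bounded, so convergence to 0 is obtained for radii \<open>t\<close> strictly
  below \<open>s\<close>.
\<close>

lemma scaled_powers_step:
  fixes c :: "'a::complex_banach_algebra_1"
  assumes l: "\<And>w. u w * (1 - w *\<^sub>C c) = 1"
    and M: "\<And>w. cmod w \<le> R \<Longrightarrow> norm (u w) \<le> M"
    and L: "\<And>w v. cmod w \<le> R \<Longrightarrow> cmod v \<le> R \<Longrightarrow> norm (u w - u v) \<le> L * cmod (w - v)"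
    and lim: "(\<lambda>n. r ^ n *\<^sub>R c ^ n) \<longlonglongrightarrow> 0"
    and rs: "0 \<le> r" "r \<le> s" "s \<le> R" "L * (s - r) \<le> 1/4"
    and t: "0 \<le> t" "t < s"
  shows "(\<lambda>n. t ^ n *\<^sub>R c ^ n) \<longlonglongrightarrow> 0"
proof -
  let ?A = "resolvent_average u"
  have bound: "norm (?A n r) \<le> M" if "n > 0" for n
    unfolding resolvent_average_def
    using rs that by (intro norm_sum_over_n_le M) (auto simp: norm_mult)
  have diff: "norm (?A n s - ?A n r) \<le> 1/4" if n: "n > 0" for n
  proof -
    have "norm (u (cis x * of_real s) - u (cis x * of_real r)) \<le> L * (s - r)" for x
    proof -
      have "cmod (cis x * of_real s - cis x * of_real r) = s - r"
        using rs by (simp add: norm_mult flip: right_diff_distrib of_real_diff)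
      with L[of "cis x * of_real s" "cis x * of_real r"] rs show ?thesis
        by (simp add: norm_mult)
    qed
    then have "norm (?A n s - ?A n r) \<le> L * (s - r)"
      unfolding resolvent_average_def
      by (simp only: scaleR_diff_right[symmetric] sum_subtractf[symmetric]) (intro norm_sum_over_n_le n)
    with rs show ?thesis by simp
  qed
  have "(\<lambda>n. M * norm (r ^ n *\<^sub>R c ^ n)) \<longlonglongrightarrow> 0"
    using tendsto_mult_right_zero[OF tendsto_norm_zero[OF lim]] .
  then have "\<forall>\<^sub>F n in sequentially. M * norm (r ^ n *\<^sub>R c ^ n) < 1/4"
    by (rule order_tendstoD) simp
  then have ev: "\<forall>\<^sub>F n in sequentially. norm (s ^ n *\<^sub>R c ^ n) \<le> 1"
    using eventually_gt_at_top[of 0]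
  proof eventually_elim
    case (elim n)
    have "?A n r * (1 - r ^ n *\<^sub>R c ^ n) = 1"
      using resolvent_average_inverse[of u c n r, OF l] elim by simp
    then have "?A n r - 1 = ?A n r * (r ^ n *\<^sub>R c ^ n)"
      by (simp only: right_diff_distrib) (simp add: algebra_simps)
    then have "norm (?A n r - 1) \<le> norm (?A n r) * norm (r ^ n *\<^sub>R c ^ n)"
      by (metis norm_mult_ineq)
    also have "\<dots> \<le> M * norm (r ^ n *\<^sub>R c ^ n)"
      using bound elim by (intro mult_right_mono) auto
    finally have "norm (?A n r - 1) \<le> 1/4"
      using elim by simp
    then have half: "norm (?A n s - 1) \<le> 1/2"
      using diff[of n] elim norm_triangle_ineq[of "?A n s - ?A n r" "?A n r - 1"] by simp
    define m where "m = s ^ n *\<^sub>R c ^ n"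
    have "?A n s * (1 - m) = 1"
      using resolvent_average_inverse[of u c n s, OF l] elim by (simp add: m_def)
    \<comment> \<open>Solving for \<open>m\<close> in this form gives \<open>norm m \<le> 1/2 + 1/2 * norm m\<close>.\<close>
    then have "m = (?A n s - 1) - (?A n s - 1) * m"
      by (simp add: algebra_simps)
    then have "norm m \<le> norm (?A n s - 1) + norm ((?A n s - 1) * m)"
      using norm_triangle_ineq4[of "?A n s - 1" "(?A n s - 1) * m"] by simp
    also have "\<dots> \<le> norm (?A n s - 1) + norm (?A n s - 1) * norm m"
      by (intro add_left_mono norm_mult_ineq)
    also have "\<dots> \<le> 1/2 + 1/2 * norm m"
      using half by (intro add_mono mult_right_mono) auto
    finally show ?case by (simp add: m_def)
  qed
  have "(\<lambda>n. (t / s) ^ n) \<longlonglongrightarrow> 0"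
    using t by (intro LIMSEQ_power_zero) simp
  then show ?thesis
  proof (rule Lim_null_comparison[rotated])
    show "\<forall>\<^sub>F n in sequentially. norm (t ^ n *\<^sub>R c ^ n) \<le> (t / s) ^ n"
      using ev
    proof eventually_elim
      case (elim n)
      have "norm (t ^ n *\<^sub>R c ^ n) = (t / s) ^ n * norm (s ^ n *\<^sub>R c ^ n)"
        using t by (simp add: power_divide)
      also have "\<dots> \<le> (t / s) ^ n * 1"
        using elim t by (intro mult_left_mono) auto
      finally show ?case by simp
    qed
  qed
qed

lemma quasinilpotents_scaled_powers:
  fixes c :: "'a::complex_banach_algebra_1"
  assumes c: "c \<in> quasinilpotents" and K: "K \<ge> 0"
  shows "(\<lambda>n. K ^ n *\<^sub>R c ^ n) \<longlonglongrightarrow> 0"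
proof -
  have "\<exists>u. u * (1 - w *\<^sub>C c) = 1 \<and> (1 - w *\<^sub>C c) * u = 1" for w
    using quasinilpotents_invertible[OF c, of w] unfolding two_sided_invertible_def by blast
  then obtain u where u: "\<And>w. u w * (1 - w *\<^sub>C c) = 1" "\<And>w. (1 - w *\<^sub>C c) * u w = 1"
    by metis
  \<comment> \<open>The disc is larger than \<open>K\<close> because a step overshoots its target radius.\<close>
  define R where "R = K + 1"
  have "bounded (u ` cball 0 R)"
    by (intro compact_imp_bounded compact_continuous_image continuous_on_resolvent[OF u]) simp
  then obtain M where M: "M > 0" "\<And>w. cmod w \<le> R \<Longrightarrow> norm (u w) \<le> M"
    by (auto simp: bounded_pos)
  define L where "L = M * norm c * M"
  have L0: "L \<ge> 0" using M by (simp add: L_def)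
  have L: "norm (u w - u v) \<le> L * cmod (w - v)" if "cmod w \<le> R" "cmod v \<le> R" for w v
  proof -
    have "norm (u w - u v) \<le> norm (u w) * (cmod (w - v) * norm c) * norm (u v)"
      by (rule norm_resolvent_diff_le[OF u])
    also have "\<dots> \<le> M * (cmod (w - v) * norm c) * M"
      using M that by (intro mult_mono) auto
    finally show ?thesis by (simp add: L_def mult_ac)
  qed
  \<comment> \<open>Each step gains \<open>h\<close>: it compares the radius \<open>i * h\<close> with \<open>(i + 2) * h\<close> and keeps
    \<open>(i + 1) * h\<close>. So \<open>N\<close> must make \<open>2 * h\<close> small against both the Lipschitz constant and the
    margin \<open>R - K\<close>.\<close>
  obtain N :: nat where N: "real N > max 1 (2 * K + 8 * L * K)"
    using reals_Archimedean2 by blast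
  define h where "h = K / real N"
  have h: "h \<ge> 0" "2 * h \<le> 1" "L * (2 * h) \<le> 1/4" "real N * h = K"
    using N K mult_nonneg_nonneg[OF L0 K] by (simp_all add: h_def divide_simps)
  have "(\<lambda>n. (real i * h) ^ n *\<^sub>R c ^ n) \<longlonglongrightarrow> 0" if "i \<le> N" for i
    using that
  proof (induction i)
    case 0
    show ?case
      by (rule tendsto_eventually) (auto simp: eventually_at_top_linorder intro!: exI[of _ 1])
  next
    case (Suc i)
    have iK: "real i * h \<le> K"
      using Suc.prems h mult_right_mono[of "real i" "real N" h] by simp
    show ?case
    proof (cases "h = 0")
      case True
      with Suc show ?thesis by simp
    next
      case False
      show ?thesis
      proof (rule scaled_powers_step[OF u(1) M(2) L])
        show "(\<lambda>n. (real i * h) ^ n *\<^sub>R c ^ n) \<longlonglongrightarrow> 0"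
          using Suc by simp
        show "real i * h + 2 * h \<le> R"
          using iK h by (simp add: R_def)
        show "real (Suc i) * h < real i * h + 2 * h"
          using False h by (simp add: algebra_simps)
      qed (use h in auto)
    qed
  qed
  from this[of N] show ?thesis
    using h by simp
qed

section \<open>Left and right inverses of intertwined elements\<close>

text \<open>
  The idempotent \<open>1 - x * a\<close> commutes with \<open>a\<close>, and \<open>a - a * x * a = (1 - x * a) * a\<close>. The
  exponent is positive, since for exponent 0 the two sides are \<open>1\<close> and \<open>1 - x * a\<close>.
\<close>

lemma left_complement_power:
  fixes a x :: "'a::ring_1"
  assumes "a * x * a = x * a^2" "x^2 * a = x"
  shows "(a - a * x * a) ^ Suc n = (1 - x * a) * a ^ Suc n"
proof -
  let ?p = "1 - x * a"
  have d: "a - a * x * a = ?p * a"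
    using assms(1) by (simp add: algebra_simps power2_eq_square)
  have comm: "a * ?p = ?p * a"
    using assms(1) by (simp add: algebra_simps power2_eq_square)
  have "x * a * (x * a) = x * (a * x * a)" by (simp add: mult.assoc)
  also have "\<dots> = x^2 * a * a" unfolding assms(1) by (simp add: power2_eq_square mult.assoc)
  finally have "x * a * (x * a) = x * a" by (simp add: assms(2))
  then have idem: "?p * ?p = ?p" by (simp add: algebra_simps)
  have "(?p * a) ^ Suc n = ?p * a ^ Suc n"
  proof (induction n)
    case (Suc n)
    have "(?p * a) ^ Suc (Suc n) = ?p * (a * ?p) * a ^ Suc n"
      using Suc by (simp only: power_Suc[of _ "Suc n"] mult.assoc)
    also have "\<dots> = (?p * ?p) * a ^ Suc (Suc n)"
      unfolding comm by (simp only: power_Suc mult.assoc)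
    finally show ?case by (simp only: idem)
  qed simp
  then show ?thesis by (simp only: d)
qed

lemma right_complement_power:
  fixes b y :: "'a::ring_1"
  assumes "b * y * b = b^2 * y" "b * y^2 = y"
  shows "(b - b * y * b) ^ Suc n = b ^ Suc n * (1 - b * y)"
proof -
  let ?q = "1 - b * y"
  have d: "b - b * y * b = b * ?q"
    using assms(1) by (simp add: algebra_simps power2_eq_square)
  have comm: "?q * b = b * ?q"
    using assms(1) by (simp add: algebra_simps power2_eq_square)
  have "b * y * (b * y) = b * y * b * y" by (simp add: mult.assoc)
  also have "\<dots> = b * (b * y^2)" unfolding assms(1) by (simp add: power2_eq_square mult.assoc)
  finally have "b * y * (b * y) = b * y" by (simp add: assms(2))
  then have idem: "?q * ?q = ?q" by (simp add: algebra_simps)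
  have "(b * ?q) ^ Suc n = b ^ Suc n * ?q"
  proof (induction n)
    case (Suc n)
    have "(b * ?q) ^ Suc (Suc n) = b ^ Suc n * (?q * b) * ?q"
      using Suc by (simp only: power_Suc2[of _ "Suc n"] mult.assoc)
    also have "\<dots> = b ^ Suc (Suc n) * (?q * ?q)"
      unfolding comm by (simp only: power_Suc2 mult.assoc)
    finally show ?case by (simp only: idem)
  qed simp
  then show ?thesis by (simp only: d)
qed

lemma left_power_cancel:
  fixes a x :: "'a::monoid_mult"
  assumes "x^2 * a = x"
  shows "x ^ Suc n * a ^ Suc n = x * a"
proof (induction n)
  case (Suc n)
  have "x ^ Suc (Suc n) * a ^ Suc (Suc n) = x ^ n * (x^2 * a) * a ^ Suc n"
    by (simp only: power_Suc2[of x "Suc n"] power_Suc2[of x n] power_Suc[of a "Suc n"]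
        power2_eq_square mult.assoc)
  then show ?case
    using Suc by (simp only: assms power_Suc2[of x n])
qed simp

lemma right_power_cancel:
  fixes b y :: "'a::monoid_mult"
  assumes "b * y^2 = y"
  shows "b ^ Suc n * y ^ Suc n = b * y"
proof (induction n)
  case (Suc n)
  have "b ^ Suc (Suc n) * y ^ Suc (Suc n) = b ^ Suc n * (b * y^2) * y ^ n"
    by (simp only: power_Suc2[of b "Suc n"] power_Suc[of y] power2_eq_square mult.assoc)
  then show ?case
    using Suc by (simp only: assms power_Suc[of y n] mult.assoc)
qed simp

lemma intertwine_power:
  fixes a b z :: "'a::monoid_mult"
  assumes "a * z = z * b"
  shows "a ^ n * z = z * b ^ n"
proof (induction n)
  case (Suc n)
  have "a ^ Suc n * z = a * (a ^ n * z)" by (simp add: mult.assoc)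
  also have "\<dots> = (a * z) * b ^ n" by (simp add: Suc mult.assoc)
  also have "\<dots> = z * b ^ Suc n" by (simp add: assms mult.assoc)
  finally show ?case .
qed simp

lemma eq_zero_if_norm_le_scaled_powers:
  fixes v d :: "'a::real_normed_algebra_1"
  assumes lim: "(\<lambda>n. K ^ n *\<^sub>R d ^ n) \<longlonglongrightarrow> 0" and K: "K \<ge> 0"
    and le: "\<And>n. norm v \<le> C * (K ^ Suc n * norm (d ^ Suc n))"
  shows "v = 0"
proof -
  have "(\<lambda>n. C * norm (K ^ Suc n *\<^sub>R d ^ Suc n)) \<longlonglongrightarrow> 0"
    by (intro tendsto_mult_right_zero tendsto_norm_zero LIMSEQ_Suc[OF lim])
  then have "norm v \<le> 0"
    by (rule LIMSEQ_le_const) (use le K in \<open>auto simp del: power_Suc\<close>)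
  then show ?thesis by simp
qed

text \<open>
  The decay hypotheses cover every rate \<open>K\<close> because they have to beat \<open>norm y ^ n\<close> and
  \<open>norm x ^ n\<close> respectively.
\<close>

lemma intertwined_inverses:
  fixes a b z x y :: "'a::real_normed_algebra_1"
  assumes z: "a * z = z * b"
    and x: "a * x * a = x * a^2" "x^2 * a = x"
    and y: "b * y * b = b^2 * y" "b * y^2 = y"
    and da: "\<And>K. K \<ge> 0 \<Longrightarrow> (\<lambda>n. K ^ n *\<^sub>R (a * x * a - a) ^ n) \<longlonglongrightarrow> 0"
    and db: "\<And>K. K \<ge> 0 \<Longrightarrow> (\<lambda>n. K ^ n *\<^sub>R (b * y * b - b) ^ n) \<longlonglongrightarrow> 0"
  shows "x * z = z * y"
proof -
  have neg: "norm ((v - w) ^ n) = norm ((w - v) ^ n)" for v w :: 'a and n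
    using power_minus[of "w - v" n] by (cases "even n") auto
  have 1: "(1 - x * a) * z * (b * y) = 0"
  proof (rule eq_zero_if_norm_le_scaled_powers[OF da])
    fix n
    have "(1 - x * a) * z * (b * y) = (1 - x * a) * (z * b ^ Suc n) * y ^ Suc n"
      by (simp only: right_power_cancel[OF y(2), of n, symmetric] mult.assoc)
    also have "\<dots> = (1 - x * a) * a ^ Suc n * z * y ^ Suc n"
      unfolding intertwine_power[OF z, symmetric] by (simp only: mult.assoc)
    also have "\<dots> = (a - a * x * a) ^ Suc n * z * y ^ Suc n"
      by (simp only: left_complement_power[OF x])
    also have "norm \<dots> \<le> norm ((a - a * x * a) ^ Suc n) * norm z * norm y ^ Suc n"
      by (intro order_trans[OF norm_mult_ineq] mult_mono norm_mult_ineq norm_power_ineq) auto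
    finally show "norm ((1 - x * a) * z * (b * y))
        \<le> norm z * (norm y ^ Suc n * norm ((a * x * a - a) ^ Suc n))"
      by (simp only: neg[of a "a * x * a"] mult.commute mult.left_commute)
  qed simp_all
  have 2: "x * a * z * (1 - b * y) = 0"
  proof (rule eq_zero_if_norm_le_scaled_powers[OF db])
    fix n
    have "x * a * z * (1 - b * y) = x ^ Suc n * (a ^ Suc n * z) * (1 - b * y)"
      by (simp only: left_power_cancel[OF x(2), of n, symmetric] mult.assoc)
    also have "\<dots> = x ^ Suc n * z * (b ^ Suc n * (1 - b * y))"
      unfolding intertwine_power[OF z] by (simp only: mult.assoc)
    also have "\<dots> = x ^ Suc n * z * (b - b * y * b) ^ Suc n"
      by (simp only: right_complement_power[OF y])
    also have "norm \<dots> \<le> norm x ^ Suc n * norm z * norm ((b - b * y * b) ^ Suc n)"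
      by (intro order_trans[OF norm_mult_ineq] mult_mono norm_mult_ineq norm_power_ineq) auto
    finally show "norm (x * a * z * (1 - b * y))
        \<le> norm z * (norm x ^ Suc n * norm ((b * y * b - b) ^ Suc n))"
      by (simp only: neg[of b "b * y * b"] mult.commute mult.left_commute)
  qed simp_all
  have pq: "x * a * z = z * (b * y)"
    using 1 2 by (simp add: algebra_simps)
  have "x * z = x^2 * a * z" by (simp add: x)
  also have "\<dots> = x * (x * a * z)" by (simp add: power2_eq_square mult.assoc)
  also have "\<dots> = x * (z * b) * y" unfolding pq by (simp only: mult.assoc)
  also have "\<dots> = (x * a * z) * y" by (simp only: z[symmetric] mult.assoc)
  also have "\<dots> = z * (b * y^2)" unfolding pq by (simp only: power2_eq_square mult.assoc)
  finally show ?thesis by (simp add: y)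
qed

lemma nilpotent_scaled_powers:
  fixes d :: "'a::real_normed_algebra_1"
  assumes "d ^ m = 0"
  shows "(\<lambda>n. K ^ n *\<^sub>R d ^ n) \<longlonglongrightarrow> 0"
proof (rule tendsto_eventually, rule eventually_sequentiallyI)
  fix n assume "m \<le> n"
  then have "d ^ n = d ^ m * d ^ (n - m)" by (simp flip: power_add)
  with assms show "K ^ n *\<^sub>R d ^ n = 0" by simp
qed

text \<open>
  If \<open>x * a ^ (j + 1) = a ^ j\<close>, then \<open>(1 - x * a) * a ^ (j + 1) = 0\<close>, and up to sign this is the
  power \<open>j + 1\<close> of \<open>a * x * a - a\<close>.
\<close>

lemma left_Drazin_complement_nilpotent:
  fixes a x :: "'a::ring_1"
  assumes "left_Drazin_inverse a x"
  shows "\<exists>m. (a * x * a - a) ^ m = 0"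
proof -
  obtain j where x: "a * x * a = x * a^2" "x^2 * a = x" and j: "x * a ^ (j + 1) = a ^ j"
    using assms unfolding left_Drazin_inverse_def by blast
  have "(1 - x * a) * a ^ Suc j = (a ^ j - x * a ^ (j + 1)) * a"
    by (simp add: algebra_simps power_commutes)
  then have "(a - a * x * a) ^ Suc j = 0"
    by (simp only: left_complement_power[OF x] j) simp
  then have "(- (a - a * x * a)) ^ Suc j = 0"
    by (subst power_minus) simp
  then show ?thesis by (auto simp del: power_Suc)
qed

lemma right_Drazin_complement_nilpotent:
  fixes b y :: "'a::ring_1"
  assumes "right_Drazin_inverse b y"
  shows "\<exists>m. (b * y * b - b) ^ m = 0"
proof -
  obtain j where y: "b * y * b = b^2 * y" "b * y^2 = y" and j: "b ^ (j + 1) * y = b ^ j"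
    using assms unfolding right_Drazin_inverse_def by blast
  have "b ^ Suc j * (1 - b * y) = b ^ Suc j - b ^ Suc j * b * y"
    by (simp only: right_diff_distrib mult_1_right mult.assoc)
  also have "\<dots> = b * (b ^ j - b ^ (j + 1) * y)"
    by (simp only: power_commutes) (simp add: right_diff_distrib mult.assoc)
  finally have "(b - b * y * b) ^ Suc j = 0"
    by (simp only: right_complement_power[OF y] j) simp
  then have "(- (b - b * y * b)) ^ Suc j = 0"
    by (subst power_minus) simp
  then show ?thesis by (auto simp del: power_Suc)
qed

theorem proposition2p2:
  fixes a b z :: "'a::complex_banach_algebra_1"
  assumes "a * z = z * b"
  shows "(\<forall>x y. left_Drazin_inverse a x \<and> right_Drazin_inverse b y \<longrightarrow> x * z = z * y) \<and>
         (\<forall>x y. left_gen_Drazin_inverse a x \<and> right_gen_Drazin_inverse b y \<longrightarrow> x * z = z * y)"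
proof (intro conjI allI impI; elim conjE)
  fix x y assume xy: "left_Drazin_inverse a x" "right_Drazin_inverse b y"
  obtain m n where "(a * x * a - a) ^ m = 0" "(b * y * b - b) ^ n = 0"
    using left_Drazin_complement_nilpotent[OF xy(1)] right_Drazin_complement_nilpotent[OF xy(2)]
    by blast
  with xy show "x * z = z * y"
    by (intro intertwined_inverses[OF assms] nilpotent_scaled_powers)
      (auto simp: left_Drazin_inverse_def right_Drazin_inverse_def)
next
  fix x y assume "left_gen_Drazin_inverse a x" "right_gen_Drazin_inverse b y"
  then show "x * z = z * y"
    by (intro intertwined_inverses[OF assms] quasinilpotents_scaled_powers)
      (auto simp: left_gen_Drazin_inverse_def right_gen_Drazin_inverse_def)
qed

end
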